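(* A connected graph $G$ with no isolated vertices is $\gamma_{tR}$-ER-critical if and only if there exist an integer $n\geq 1$ and integers $k_1\geq k_2\geq\dots\geq k_n\geq 0$ with $k_i\neq 1$ for all $1\leq i\leq n$ such that $G$ is isomorphic to the graph obtained from the star $K_{1,n}$ by attaching $k_i$ new pendant vertices to the $i$-th leaf of the star, for each $1\leq i\leq n$.
   Context: All graphs are finite and simple. A total Roman dominating function (TRD-function) on a graph $G$ with no isolated vertices is a function $f:V(G)\to\{0,1,2\}$ such that every vertex $v$ with $f(v)=0$ is adjacent to some $u$ with $f(u)=2$, and the subgraph induced by $\{w:f(w)>0\}$ has no isolated vertices; its weight is $\sum_v f(v)$ and $\gamma_{tR}(G)$ is the minimum weight. For an edge $e$ incident with a vertex of degree $1$, define $\gamma_{tR}(G-e)=\infty$. A graph $G$ with no isolated vertices is $\gamma_{tR}$-ER-critical if $\gamma_{tR}(G-e)>\gamma_{tR}(G)$ for every edge $e\in E(G)$. (When $n=1$, either vertex of $K_{1,1}$ may be regarded as the centre.) *)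

theory Defs
  imports "Graph_Theory.Graph_Theory" "HOL-Library.Extended_Nat"
begin

text \<open>
  A finite simple graph is a \<^locale>\<open>pair_graph\<close>: a finite, loop-free, symmetric digraph
  whose arcs are pairs of vertices. An undirected edge \<open>uv\<close> is the pair of arcs
  \<open>(u, v)\<close>, \<open>(v, u)\<close>, and the degree of a vertex is its \<^const>\<open>out_degree\<close>.
\<close>

definition no_isolated_verts :: "('a, 'b) pre_digraph \<Rightarrow> bool" where
  "no_isolated_verts G \<longleftrightarrow> (\<forall>v \<in> verts G. \<exists>u \<in> verts G. v \<rightarrow>\<^bsub>G\<^esub> u)"

definition del_edge :: "'a pair_pre_digraph \<Rightarrow> 'a \<Rightarrow> 'a \<Rightarrow> 'a pair_pre_digraph" where
  "del_edge G u v = G\<lparr>parcs := parcs G - {(u, v), (v, u)}\<rparr>"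

text \<open>Values of \<open>f\<close> outside the vertex set are irrelevant.\<close>

definition trd_function :: "'a pair_pre_digraph \<Rightarrow> ('a \<Rightarrow> nat) \<Rightarrow> bool" where
  "trd_function G f \<longleftrightarrow>
     f ` pverts G \<subseteq> {0, 1, 2} \<and>
     (\<forall>v \<in> pverts G. f v = 0 \<longrightarrow> (\<exists>u \<in> pverts G. v \<rightarrow>\<^bsub>G\<^esub> u \<and> f u = 2)) \<and>
     no_isolated_verts (G \<restriction> {w \<in> pverts G. f w > 0})"

definition trd_weight :: "'a pair_pre_digraph \<Rightarrow> ('a \<Rightarrow> nat) \<Rightarrow> nat" where
  "trd_weight G f = (\<Sum>v \<in> pverts G. f v)"

text \<open>Only meaningful for graphs without isolated vertices: the others have no TRD-function.\<close>

definition gamma_tR :: "'a pair_pre_digraph \<Rightarrow> nat" where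
  "gamma_tR G = Min {trd_weight G f | f. trd_function G f}"

definition gamma_tR_del :: "'a pair_pre_digraph \<Rightarrow> 'a \<Rightarrow> 'a \<Rightarrow> enat" where
  "gamma_tR_del G u v =
     (if out_degree G u = 1 \<or> out_degree G v = 1 then \<infinity> else enat (gamma_tR (del_edge G u v)))"

definition gamma_tR_ER_critical :: "'a pair_pre_digraph \<Rightarrow> bool" where
  "gamma_tR_ER_critical G \<longleftrightarrow>
     no_isolated_verts G \<and> (\<forall>(u, v) \<in> parcs G. gamma_tR_del G u v > enat (gamma_tR G))"

datatype star_vert = Centre | Leaf nat | Pendant nat nat

definition star :: "nat \<Rightarrow> star_vert pair_pre_digraph" where
  "star n =
     \<lparr>pverts = {Centre} \<union> Leaf ` {1..n},
      parcs = (\<Union>i \<in> {1..n}. {(Centre, Leaf i), (Leaf i, Centre)})\<rparr>"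

text \<open>For each \<open>i\<close> in \<open>{1..n}\<close>, the leaf \<open>Leaf i\<close> receives the pendant vertices
  \<open>Pendant i 1, \<dots>, Pendant i (k i)\<close>.\<close>

definition star_with_pendants :: "nat \<Rightarrow> (nat \<Rightarrow> nat) \<Rightarrow> star_vert pair_pre_digraph" where
  "star_with_pendants n k =
     \<lparr>pverts = pverts (star n) \<union> (\<Union>i \<in> {1..n}. Pendant i ` {1..k i}),
      parcs = parcs (star n) \<union>
        (\<Union>i \<in> {1..n}. \<Union>j \<in> {1..k i}. {(Leaf i, Pendant i j), (Pendant i j, Leaf i)})\<rparr>"

lemma pair_graph_star: "pair_graph (star n)"
  by unfold_locales (auto simp: star_def symmetric_def sym_def)

lemma pair_graph_star_with_pendants: "pair_graph (star_with_pendants n k)"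
  by unfold_locales
    (auto simp: star_with_pendants_def star_def symmetric_def sym_def image_iff Bex_def)

end

theory Submission
  imports Defs
begin

text \<open>
  If \<open>G\<close> is critical and \<open>f\<close> is a TRD-function of minimum weight, then no edge is superfluous
  for \<open>f\<close>. Hence vertices of value \<open>0\<close> are pendant vertices attached to vertices of value \<open>2\<close>,
  and the positive vertices induce a star forest, which by connectedness is a single star.
  A leaf \<open>l\<close> of this star with exactly one pendant vertex \<open>p\<close> is excluded by shifting \<open>f\<close> to
  the value \<open>1\<close> on both \<open>l\<close> and \<open>p\<close>, which makes the edge from \<open>l\<close> to the centre superfluous;
  this fails only if the star is a single edge, and then \<open>l\<close> can be taken as the centre, unless
  \<open>G\<close> is a path on four vertices, which is not critical.

  Conversely, let \<open>c\<close> be the centre and \<open>l\<close> a leaf with at least two pendant vertices. A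
  TRD-function of \<open>G - cl\<close> has weight at least \<open>3\<close> on \<open>l\<close> and its pendant vertices and may be
  assumed positive at \<open>c\<close>; overwriting it by \<open>2\<close> at \<open>l\<close> and \<open>0\<close> at the pendant vertices
  gives a TRD-function of \<open>G\<close> of smaller weight.
\<close>

section \<open>Neighbourhoods and total Roman dominating functions\<close>

definition nbrs :: "'a pair_pre_digraph \<Rightarrow> 'a \<Rightarrow> 'a set" where
  "nbrs G v = parcs G `` {v}"

lemma in_nbrs_iff [simp]: "w \<in> nbrs G v \<longleftrightarrow> (v, w) \<in> parcs G"
  by (simp add: nbrs_def)

lemma (in pair_graph) finite_nbrs [simp]: "finite (nbrs G v)"
  by (rule finite_subset[OF _ pair_finite_verts]) (auto dest: in_arcsD2)

lemma (in pair_graph) out_degree_eq_card_nbrs: "out_degree G v = card (nbrs G v)"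
proof -
  have "out_arcs G v = Pair v ` nbrs G v"
    by (auto simp: out_arcs_def)
  then show ?thesis
    by (simp add: out_degree_def card_image inj_on_def)
qed

lemma no_isolated_verts_pair_iff:
  assumes "pair_graph G"
  shows "no_isolated_verts G \<longleftrightarrow> (\<forall>v \<in> pverts G. nbrs G v \<noteq> {})"
proof -
  interpret pair_graph G by fact
  show ?thesis
    by (simp add: no_isolated_verts_def ex_in_conv[symmetric] Bex_def) (metis in_arcsD2)
qed

section \<open>Deletion of an edge\<close>

lemma pverts_del_edge [simp]: "pverts (del_edge G u v) = pverts G"
  by (simp add: del_edge_def)

lemma in_parcs_del_edge_iff [simp]:
  "(x, y) \<in> parcs (del_edge G u v) \<longleftrightarrow>
     (x, y) \<in> parcs G \<and> (x, y) \<noteq> (u, v) \<and> (x, y) \<noteq> (v, u)"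
  by (simp add: del_edge_def)

lemma del_edge_commute: "del_edge G u v = del_edge G v u"
  by (simp add: del_edge_def insert_commute)

lemma trd_weight_del_edge [simp]: "trd_weight (del_edge G u v) f = trd_weight G f"
  by (simp add: trd_weight_def)

lemma (in pair_graph) pair_graph_del_edge: "pair_graph (del_edge G u v)"
proof
  show "symmetric (del_edge G u v)"
    by (auto simp: symmetric_def intro!: symI dest: arcs_symmetric)
qed (auto simp: del_edge_def pair_finite_verts pair_finite_arcs
      dest: arc_fst_in_verts arc_snd_in_verts pair_no_loops)

section \<open>Total Roman dominating functions and their minimum weight\<close>

text \<open>A positive vertex is non-isolated in the induced subgraph exactly if it has a positive
  neighbour in \<open>G\<close>, and neighbours are automatically vertices, so all conditions become
  local conditions on \<open>nbrs\<close>.\<close>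

lemma trd_function_iff:
  assumes "pair_graph G"
  shows "trd_function G f \<longleftrightarrow>
    (\<forall>v \<in> pverts G. f v \<le> 2) \<and>
    (\<forall>v \<in> pverts G. f v = 0 \<longrightarrow> (\<exists>u \<in> nbrs G v. f u = 2)) \<and>
    (\<forall>v \<in> pverts G. f v > 0 \<longrightarrow> (\<exists>u \<in> nbrs G v. f u > 0))"
proof -
  interpret pair_graph G by fact
  have *: "x \<in> {0, 1, 2} \<longleftrightarrow> x \<le> 2" for x :: nat
    by auto
  show ?thesis
    unfolding trd_function_def no_isolated_verts_def image_subset_iff *
    by (simp add: arcs_ends_conv Bex_def Ball_def) (meson in_arcsD2)
qed

lemma trd_functionD:
  assumes "pair_graph G" "trd_function G f" "v \<in> pverts G"
  shows "f v \<le> 2"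
    and "f v = 0 \<Longrightarrow> \<exists>u. (v, u) \<in> parcs G \<and> f u = 2"
    and "f v > 0 \<Longrightarrow> \<exists>u. (v, u) \<in> parcs G \<and> f u > 0"
  using assms(2,3) unfolding trd_function_iff[OF assms(1)] Bex_def in_nbrs_iff by blast+

text \<open>The functions themselves may form an infinite set, as values outside the vertex set are
  free, but all weights are at most twice the number of vertices. This makes the \<open>Min\<close>
  in \<open>gamma_tR\<close> meaningful.\<close>

lemma finite_trd_weights:
  assumes "pair_graph G"
  shows "finite {trd_weight G f | f. trd_function G f}"
proof (rule finite_subset)
  show "{trd_weight G f | f. trd_function G f} \<subseteq> {..card (pverts G) * 2}"
    using sum_bounded_above[of "pverts G" _ "2 :: nat"]
    by (auto simp: trd_weight_def trd_function_iff[OF assms])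
qed simp

lemma gamma_tR_le:
  assumes "pair_graph G" "trd_function G f"
  shows "gamma_tR G \<le> trd_weight G f"
  unfolding gamma_tR_def using assms finite_trd_weights by (intro Min_le) auto

lemma gamma_tR_attained:
  assumes "pair_graph G" "no_isolated_verts G"
  obtains f where "trd_function G f" "trd_weight G f = gamma_tR G"
proof -
  \<comment> \<open>The constant function 1 shows that the set under \<open>Min\<close> is
    nonempty.\<close>
  have "trd_function G (\<lambda>_. 1)"
    using assms by (auto simp: trd_function_iff no_isolated_verts_pair_iff)
  then have "{trd_weight G f | f. trd_function G f} \<noteq> {}"
    by blast
  then have "gamma_tR G \<in> {trd_weight G f | f. trd_function G f}"
    unfolding gamma_tR_def using finite_trd_weights[OF assms(1)] by (rule Min_in[rotated])
  then obtain f where "gamma_tR G = trd_weight G f" "trd_function G f"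
    by blast
  then show thesis
    by (intro that) simp_all
qed


section \<open>Graphs of the form \<open>star_with_pendants\<close>\<close>

text \<open>\<open>c\<close> is the centre of the star, \<open>nbrs G c\<close> are its leaves and the remaining vertices
  are the pendant vertices.\<close>

definition two_level :: "'a pair_pre_digraph \<Rightarrow> 'a \<Rightarrow> bool" where
  "two_level G c \<longleftrightarrow>
     c \<in> pverts G \<and> nbrs G c \<noteq> {} \<and>
     (\<forall>v \<in> pverts G. v = c \<or> v \<in> nbrs G c \<or> (\<exists>l \<in> nbrs G c. nbrs G v = {l})) \<and>
     (\<forall>l \<in> nbrs G c. \<forall>w \<in> nbrs G l. w = c \<or> nbrs G w = {l}) \<and>
     (\<forall>l \<in> nbrs G c. card (nbrs G l - {c}) \<noteq> 1)"

section \<open>Isomorphism with the explicit graphs\<close>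

text \<open>An isomorphism of general digraphs carries a separate arc map and new head and tail
  functions. Between pair graphs these functions must be the projections, so the vertex map
  determines the arc map.\<close>

lemma digraph_iso_pair_iff:
  assumes "pair_wf_digraph G"
  shows "digraph_iso (with_proj G) (with_proj H) \<longleftrightarrow>
    (\<exists>\<phi>. inj_on \<phi> (pverts G) \<and> pverts H = \<phi> ` pverts G \<and>
         parcs H = map_prod \<phi> \<phi> ` parcs G)"
proof
  assume "digraph_iso G H"
  then obtain h where h: "pre_digraph.digraph_isomorphism (with_proj G) h"
      and H: "with_proj H = app_iso h (with_proj G)"
    unfolding digraph_iso_def by blast
  have *: "iso_tail h = fst" "iso_head h = snd"
    using arg_cong[OF H, of tail] arg_cong[OF H, of head] by simp_all
  have "iso_arcs h e = map_prod (iso_verts h) (iso_verts h) e" if "e \<in> parcs G" for e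
    using h that unfolding pre_digraph.digraph_isomorphism_def *
    by (auto simp: prod_eq_iff)
  then have "iso_arcs h ` parcs G = map_prod (iso_verts h) (iso_verts h) ` parcs G"
    by (intro image_cong) auto
  then show "\<exists>\<phi>. inj_on \<phi> (pverts G) \<and> pverts H = \<phi> ` pverts G \<and>
         parcs H = map_prod \<phi> \<phi> ` parcs G"
    using h arg_cong[OF H, of verts] arg_cong[OF H, of arcs]
    unfolding pre_digraph.digraph_isomorphism_def by auto
next
  assume "\<exists>\<phi>. inj_on \<phi> (pverts G) \<and> pverts H = \<phi> ` pverts G \<and>
         parcs H = map_prod \<phi> \<phi> ` parcs G"
  then obtain \<phi> where \<phi>: "inj_on \<phi> (pverts G)" "pverts H = \<phi> ` pverts G"
      "parcs H = map_prod \<phi> \<phi> ` parcs G"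
    by blast
  define h where
    "h = \<lparr>iso_verts = \<phi>, iso_arcs = map_prod \<phi> \<phi>, iso_head = snd, iso_tail = fst\<rparr>"
  have "inj_on (map_prod \<phi> \<phi>) (parcs G)"
  proof (rule inj_on_subset)
    show "inj_on (map_prod \<phi> \<phi>) (pverts G \<times> pverts G)"
      using \<phi>(1) by (intro map_prod_inj_on)
    show "parcs G \<subseteq> pverts G \<times> pverts G"
      using assms by (auto dest: pair_wf_digraph.in_arcsD1 pair_wf_digraph.in_arcsD2)
  qed
  then have "pre_digraph.digraph_isomorphism (with_proj G) h"
    unfolding pre_digraph.digraph_isomorphism_def
    using \<phi>(1) assms by (auto simp: h_def wf_digraph_wp_iff)
  moreover have "with_proj H = app_iso h (with_proj G)"
    using \<phi>(2,3) by (simp add: h_def app_iso_def with_proj_def)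
  ultimately show "digraph_iso G H"
    unfolding digraph_iso_def by blast
qed

text \<open>All clauses of \<open>two_level\<close> speak about neighbourhoods, and an injective
  \<open>\<phi>\<close> maps neighbourhoods onto neighbourhoods and preserves their
  cardinalities.\<close>

lemma two_level_image:
  assumes "pair_graph H" "two_level H c" "inj_on \<phi> (pverts H)"
    and "pverts G = \<phi> ` pverts H" "parcs G = map_prod \<phi> \<phi> ` parcs H"
  shows "two_level G (\<phi> c)"
proof -
  interpret H: pair_graph H by fact
  have nb: "nbrs G (\<phi> x) = \<phi> ` nbrs H x" if "x \<in> pverts H" for x
  proof -
    have "y = x" if "(y, z) \<in> parcs H" "\<phi> y = \<phi> x" for y z
      using that \<open>x \<in> pverts H\<close> inj_onD[OF assms(3)] H.in_arcsD1 by metis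
    then show ?thesis
      by (force simp: nbrs_def assms(5))
  qed
  have sub: "nbrs H x \<subseteq> pverts H" for x
    by (auto dest: H.in_arcsD2)
  have c: "c \<in> pverts H"
    using assms(2) by (simp add: two_level_def)
  have "card (nbrs G (\<phi> l) - {\<phi> c}) = card (nbrs H l - {c})" if "l \<in> pverts H" for l
  proof -
    have "nbrs G (\<phi> l) - {\<phi> c} = \<phi> ` (nbrs H l - {c})"
      using inj_on_image_set_diff[OF assms(3), of "nbrs H l" "{c}"] sub[of l] c
      by (simp add: nb[OF that] subset_iff)
    moreover have "inj_on \<phi> (nbrs H l - {c})"
      using assms(3) by (rule inj_on_subset) (use sub in blast)
    ultimately show ?thesis
      by (simp add: card_image)
  qed
  moreover have "\<phi> x = \<phi> y \<longleftrightarrow> x = y" if "x \<in> pverts H" "y \<in> pverts H" for x y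
    using inj_on_eq_iff[OF assms(3)] that by blast
  ultimately show ?thesis
    using assms(2) sub c
    unfolding two_level_def assms(4)
    by (simp add: nb subset_iff image_iff del: in_nbrs_iff) (smt (verit) image_empty image_insert)
qed

lemma two_level_star_with_pendants:
  assumes "n \<ge> 1" "\<forall>i \<in> {1..n}. k i \<noteq> 1"
  shows "two_level (star_with_pendants n k) Centre"
proof -
  let ?S = "star_with_pendants n k"
  have V: "pverts ?S = {Centre} \<union> Leaf ` {1..n} \<union> (\<Union>i \<in> {1..n}. Pendant i ` {1..k i})"
    by (simp add: star_with_pendants_def star_def)
  have C: "nbrs ?S Centre = Leaf ` {1..n}"
    by (auto simp: nbrs_def star_with_pendants_def star_def)
  have L: "nbrs ?S (Leaf i) = insert Centre (Pendant i ` {1..k i})" if "i \<in> {1..n}" for i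
    using that by (auto simp: nbrs_def star_with_pendants_def star_def)
  have P: "nbrs ?S (Pendant i j) = {Leaf i}" if "i \<in> {1..n}" "j \<in> {1..k i}" for i j
    using that by (auto simp: nbrs_def star_with_pendants_def star_def)
  have "card (nbrs ?S (Leaf i) - {Centre}) = k i" if "i \<in> {1..n}" for i
  proof -
    have "nbrs ?S (Leaf i) - {Centre} = Pendant i ` {1..k i}"
      using L[OF that] by auto
    then show ?thesis
      by (simp add: card_image inj_on_def)
  qed
  then show ?thesis
    unfolding two_level_def C
    using assms
    by (auto simp: L P V simp del: in_nbrs_iff)
qed

lemma ex_antimono_enumeration:
  fixes key :: "'a \<Rightarrow> nat"
  assumes "finite A"
  obtains L where "bij_betw L {1..card A} A"
    "\<And>i j. 1 \<le> i \<Longrightarrow> i \<le> j \<Longrightarrow> j \<le> card A \<Longrightarrow> key (L j) \<le> key (L i)"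
proof -
  obtain ys where ys: "set ys = A" "distinct ys"
    using finite_distinct_list[OF assms] by blast
  define xs where "xs = sort_key key ys"
  have xs: "set xs = A" "distinct xs" "sorted (map key xs)"
    using ys by (auto simp: xs_def)
  then have len: "length xs = card A"
    using distinct_card by force
  \<comment> \<open>The ascending list is read backwards: the 1-based index \<open>i\<close> becomes
    the 0-based position \<open>card A - i\<close>, so keys decrease along \<open>L\<close>.\<close>
  define L where "L i = xs ! (card A - i)" for i
  have "bij_betw (\<lambda>i. card A - i) {1..card A} {..<card A}"
    by (rule bij_betw_byWitness[where f' = "\<lambda>i. card A - i"]) auto
  moreover have "bij_betw ((!) xs) {..<card A} A"
    using xs len by (intro bij_betw_nth) auto
  ultimately have "bij_betw L {1..card A} A"
    using bij_betw_trans by (fastforce simp: L_def[abs_def] comp_def)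
  moreover have "key (L j) \<le> key (L i)" if "1 \<le> i" "i \<le> j" "j \<le> card A" for i j
    using sorted_nth_mono[OF xs(3), of "card A - j" "card A - i"] that len
    by (simp add: L_def)
  ultimately show thesis
    using that by blast
qed

text \<open>The leaves are numbered by decreasing number of pendant vertices, and the pendant
  vertices of each leaf are numbered arbitrarily; these numberings give the isomorphism.\<close>

lemma two_level_imp_digraph_iso:
  assumes "pair_graph G" "two_level G c"
  shows "\<exists>(n::nat) (k :: nat \<Rightarrow> nat). n \<ge> 1 \<and>
       (\<forall>i \<in> {1..n}. \<forall>j \<in> {1..n}. i \<le> j \<longrightarrow> k i \<ge> k j) \<and>
       (\<forall>i \<in> {1..n}. k i \<noteq> 1) \<and>
       digraph_iso G (star_with_pendants n k)"
proof -
  interpret pair_graph G by fact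
  have c: "c \<in> pverts G" "nbrs G c \<noteq> {}"
    and verts: "\<And>v. v \<in> pverts G \<Longrightarrow> v = c \<or> v \<in> nbrs G c \<or> (\<exists>l \<in> nbrs G c. nbrs G v = {l})"
    and pend: "\<And>l w. l \<in> nbrs G c \<Longrightarrow> w \<in> nbrs G l \<Longrightarrow> w = c \<or> nbrs G w = {l}"
    and ne1: "\<And>l. l \<in> nbrs G c \<Longrightarrow> card (nbrs G l - {c}) \<noteq> 1"
    using assms(2) unfolding two_level_def by blast+
  define key where "key l = card (nbrs G l - {c})" for l
  define n where "n = card (nbrs G c)"
  obtain L where L: "bij_betw L {1..n} (nbrs G c)"
    and mono: "\<And>i j. 1 \<le> i \<Longrightarrow> i \<le> j \<Longrightarrow> j \<le> n \<Longrightarrow> key (L j) \<le> key (L i)"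
    using ex_antimono_enumeration[OF finite_nbrs, of c key] unfolding n_def by blast
  have "\<exists>P. bij_betw P {1..key l} (nbrs G l - {c})" for l
    unfolding key_def by (intro ex_bij_betw_nat_finite_1) simp
  then obtain P where P: "\<And>l. bij_betw (P l) {1..key l} (nbrs G l - {c})"
    by metis
  define k where "k i = key (L i)" for i
  have Lim: "L ` {1..n} = nbrs G c" and Linj: "inj_on L {1..n}"
    using L by (auto simp: bij_betw_def)
  have Pim: "P l ` {1..key l} = nbrs G l - {c}" and Pinj: "inj_on (P l) {1..key l}" for l
    using P[of l] by (auto simp: bij_betw_def)
  have Lc: "(c, L i) \<in> parcs G" if "i \<in> {1..n}" for i
    using Lim that by (metis imageI in_nbrs_iff)
  have PL: "(L i, P (L i) j) \<in> parcs G" "P (L i) j \<noteq> c" if "j \<in> {1..k i}" for i j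
    using Pim[of "L i"] that unfolding k_def by (metis DiffD1 DiffD2 imageI in_nbrs_iff singletonI)+
  have nP: "nbrs G (P (L i) j) = {L i}" if "i \<in> {1..n}" "j \<in> {1..k i}" for i j
    using pend[of "L i" "P (L i) j"] PL[OF that(2)] Lc[OF that(1)] by auto
  \<comment> \<open>If a pendant vertex were adjacent to \<open>c\<close>, its only neighbour
    \<open>L i\<close> would be \<open>c\<close>, a loop at \<open>c\<close>.\<close>
  have PnL: "(c, P (L i) j) \<notin> parcs G" if "i \<in> {1..n}" "j \<in> {1..k i}" for i j
    using nP[OF that] Lc[OF that(1)] no_loops'
    by (metis arcs_symmetric in_nbrs_iff singletonD)
  define S where "S = star_with_pendants n k"
  \<comment> \<open>The map goes from the explicit graph to \<open>G\<close>, where it is a case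
    distinction on the datatype; the isomorphism is reversed at the end.\<close>
  define \<psi> where "\<psi> x = (case x of Centre \<Rightarrow> c | Leaf i \<Rightarrow> L i | Pendant i j \<Rightarrow> P (L i) j)" for x
  have [simp]: "\<psi> Centre = c" "\<psi> (Leaf i) = L i" "\<psi> (Pendant i j) = P (L i) j" for i j
    by (simp_all add: \<psi>_def)
  have vS: "pverts S = {Centre} \<union> Leaf ` {1..n} \<union> (\<Union>i \<in> {1..n}. Pendant i ` {1..k i})"
    by (simp add: S_def star_with_pendants_def star_def)
  have aS: "parcs S = (\<Union>i \<in> {1..n}. {(Centre, Leaf i), (Leaf i, Centre)}) \<union>
        (\<Union>i \<in> {1..n}. \<Union>j \<in> {1..k i}. {(Leaf i, Pendant i j), (Pendant i j, Leaf i)})"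
    by (simp add: S_def star_with_pendants_def star_def)
  have inj: "inj_on \<psi> (pverts S)"
  proof (rule inj_onI)
    fix x y assume xy: "x \<in> pverts S" "y \<in> pverts S" "\<psi> x = \<psi> y"
    have Lne: "L i \<noteq> c" if "i \<in> {1..n}" for i
      using Lc[OF that(1)] no_loops' by metis
    have LneP: "L i' \<noteq> P (L i) j" if "i \<in> {1..n}" "j \<in> {1..k i}" "i' \<in> {1..n}" for i j i'
      using PnL[OF that(1,2)] Lc[OF that(3)] by metis
    have Peq: "i = i' \<and> j = j'"
      if "i \<in> {1..n}" "j \<in> {1..k i}" "i' \<in> {1..n}" "j' \<in> {1..k i'}" "P (L i) j = P (L i') j'"
      for i j i' j'
    proof -
      have "L i = L i'"
        using nP[OF that(1,2)] nP[OF that(3,4)] that(5) by simp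
      then have "i = i'"
        using inj_onD[OF Linj] that by blast
      then show ?thesis
        using inj_onD[OF Pinj[of "L i"], of j j'] that by (simp add: k_def)
    qed
    have ranges: "i \<in> {1..n}" if "Leaf i \<in> pverts S" for i
      using that unfolding vS by auto
    have rangesP: "i \<in> {1..n}" "j \<in> {1..k i}" if "Pendant i j \<in> pverts S" for i j
      using that unfolding vS by auto
    show "x = y"
    proof (cases x)
      case Centre
      with xy show ?thesis
        using Lne[OF ranges] PL(2)[OF rangesP(2)] by (cases y) force+
    next
      case (Leaf i)
      with xy show ?thesis
        using Lne[OF ranges] LneP[OF rangesP] ranges inj_onD[OF Linj]
        by (cases y) auto
    next
      case (Pendant i j)
      with xy show ?thesis
        using PL(2)[OF rangesP(2)] LneP[OF rangesP ranges, symmetric] Peq[OF rangesP rangesP]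
        by (cases y) force+
    qed
  qed
  have im: "pverts G = \<psi> ` pverts S"
  proof (intro equalityI subsetI)
    fix v assume v: "v \<in> pverts G"
    consider "v = c" | "v \<in> nbrs G c" | l where "v \<noteq> c" "l \<in> nbrs G c" "nbrs G v = {l}"
      using verts[OF v] by blast
    then show "v \<in> \<psi> ` pverts S"
    proof cases
      case 1
      then show ?thesis by (auto simp: vS intro!: rev_image_eqI[of Centre])
    next
      case 2
      then obtain i where "i \<in> {1..n}" "v = L i"
        using Lim by blast
      then show ?thesis by (auto simp: vS intro!: rev_image_eqI[of "Leaf i"])
    next
      case 3
      then obtain i where i: "i \<in> {1..n}" "l = L i"
        using Lim by blast
      have "v \<in> nbrs G l - {c}"
        using 3 by (auto intro: arcs_symmetric simp: set_eq_iff)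
      then obtain j where "j \<in> {1..k i}" "v = P (L i) j"
        unfolding i k_def Pim[symmetric] by blast
      then show ?thesis
        using i by (auto simp: vS intro!: rev_image_eqI[of "Pendant i j"])
    qed
  next
    fix v assume "v \<in> \<psi> ` pverts S"
    then show "v \<in> pverts G"
      using c(1) in_arcsD2[OF Lc] in_arcsD2[OF PL(1)] by (auto simp: vS)
  qed
  have arcs: "parcs G = map_prod \<psi> \<psi> ` parcs S"
  proof (intro equalityI subrelI)
    \<comment> \<open>Every arc either meets the centre, treated here, or joins a leaf to one of its
      pendant vertices, treated in \<open>lp\<close>.\<close>
    have cl: "(c, w) \<in> map_prod \<psi> \<psi> ` parcs S \<and> (w, c) \<in> map_prod \<psi> \<psi> ` parcs S"
      if "(c, w) \<in> parcs G" for w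
    proof -
      have "w \<in> L ` {1..n}"
        unfolding Lim using that by simp
      then obtain i where "i \<in> {1..n}" "w = L i"
        by blast
      then have "(Centre, Leaf i) \<in> parcs S" "(Leaf i, Centre) \<in> parcs S"
          "(c, w) = map_prod \<psi> \<psi> (Centre, Leaf i)" "(w, c) = map_prod \<psi> \<psi> (Leaf i, Centre)"
        unfolding aS by auto
      then show ?thesis
        by blast
    qed
    have lp: "(L i, w) \<in> map_prod \<psi> \<psi> ` parcs S \<and> (w, L i) \<in> map_prod \<psi> \<psi> ` parcs S"
      if "i \<in> {1..n}" "w \<noteq> c" "(L i, w) \<in> parcs G" for i w
    proof -
      have "w \<in> P (L i) ` {1..k i}"
        unfolding k_def Pim using that by simp
      then obtain j where "j \<in> {1..k i}" "w = P (L i) j"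
        by blast
      with that(1) have "(Leaf i, Pendant i j) \<in> parcs S" "(Pendant i j, Leaf i) \<in> parcs S"
          "(L i, w) = map_prod \<psi> \<psi> (Leaf i, Pendant i j)"
          "(w, L i) = map_prod \<psi> \<psi> (Pendant i j, Leaf i)"
        unfolding aS by auto
      then show ?thesis
        by blast
    qed
    fix u v assume uv: "(u, v) \<in> parcs G"
    consider "u = c" | "v = c" | "u \<noteq> c" "v \<noteq> c" "u \<in> nbrs G c"
      | l where "u \<noteq> c" "l \<in> nbrs G c" "nbrs G u = {l}"
      using verts[of u] uv in_arcsD1 by blast
    then show "(u, v) \<in> map_prod \<psi> \<psi> ` parcs S"
    proof cases
      case 1
      then show ?thesis using cl uv by blast
    next
      case 2
      then show ?thesis using cl arcs_symmetric[OF uv] by blast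
    next
      case 3
      then obtain i where "i \<in> {1..n}" "u = L i"
        using Lim by blast
      then show ?thesis using lp 3 uv by blast
    next
      case 4
      then have "v = l"
        using uv by (metis in_nbrs_iff singletonD)
      moreover obtain i where "i \<in> {1..n}" "l = L i"
        using Lim 4 by blast
      ultimately show ?thesis
        using lp 4 arcs_symmetric[OF uv] by blast
    qed
  next
    fix u v assume "(u, v) \<in> map_prod \<psi> \<psi> ` parcs S"
    then show "(u, v) \<in> parcs G"
      using Lc PL(1) arcs_symmetric unfolding aS by auto
  qed
  have S: "pair_graph S"
    by (simp add: S_def pair_graph_star_with_pendants)
  interpret S: pair_graph S by fact
  have "digraph_iso S G"
    using inj im arcs digraph_iso_pair_iff[of S G] S.pair_wf_digraph by blast
  then have "digraph_iso G S"
    using S.wf_digraph_axioms by (rule digraph_iso_swap[rotated])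
  moreover have "n \<ge> 1"
    using c(2) by (simp add: n_def Suc_le_eq card_gt_0_iff)
  moreover have "\<forall>i \<in> {1..n}. k i \<noteq> 1"
    using ne1 Lim unfolding k_def key_def by blast
  moreover have "\<forall>i \<in> {1..n}. \<forall>j \<in> {1..n}. i \<le> j \<longrightarrow> k i \<ge> k j"
    using mono unfolding k_def by simp
  ultimately show ?thesis
    unfolding S_def by blast
qed

lemma two_level_iff_digraph_iso:
  assumes "pair_graph G"
  shows "(\<exists>c. two_level G c) \<longleftrightarrow> (\<exists>(n::nat) (k :: nat \<Rightarrow> nat). n \<ge> 1 \<and>
       (\<forall>i \<in> {1..n}. \<forall>j \<in> {1..n}. i \<le> j \<longrightarrow> k i \<ge> k j) \<and>
       (\<forall>i \<in> {1..n}. k i \<noteq> 1) \<and>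
       digraph_iso G (star_with_pendants n k))"
    (is "?L \<longleftrightarrow> ?R")
proof
  assume ?L
  then show ?R
    using two_level_imp_digraph_iso[OF assms] by blast
next
  assume ?R
  then obtain n k where nk: "n \<ge> 1" "\<forall>i \<in> {1..n}. k i \<noteq> 1"
    and iso: "digraph_iso G (star_with_pendants n k)"
    by blast
  interpret pair_graph G by fact
  interpret S: pair_graph "star_with_pendants n k"
    by (rule pair_graph_star_with_pendants)
  have "digraph_iso (star_with_pendants n k) G"
    using wf_digraph_axioms iso by (rule digraph_iso_swap)
  then have "\<exists>\<phi>. inj_on \<phi> (pverts (star_with_pendants n k)) \<and>
      pverts G = \<phi> ` pverts (star_with_pendants n k) \<and>
      parcs G = map_prod \<phi> \<phi> ` parcs (star_with_pendants n k)"
    by (rule iffD1[OF digraph_iso_pair_iff[OF S.pair_wf_digraph]])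
  then show ?L
    using two_level_image[OF S.pair_graph two_level_star_with_pendants[OF nk]]
    by (elim exE conjE) (rule exI)
qed


section \<open>Two-level trees are critical\<close>

text \<open>The additive form avoids truncated subtraction on natural numbers.\<close>

lemma trd_weight_upd:
  assumes "finite (pverts G)" "x \<in> pverts G"
  shows "trd_weight G (f(x := a)) + f x = trd_weight G f + a"
  using assms by (simp add: trd_weight_def sum.remove[of _ x])

lemma two_level_nbrs_ne:
  assumes "pair_graph G" "two_level G c" "v \<in> pverts G"
  shows "nbrs G v \<noteq> {}"
proof -
  interpret pair_graph G by fact
  consider "v = c" | "(c, v) \<in> parcs G" | l where "nbrs G v = {l}"
    using assms(2,3) unfolding two_level_def by auto
  then show ?thesis
  proof cases
    case 1
    then show ?thesis using assms(2) by (simp add: two_level_def)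
  next
    case 2
    then have "c \<in> nbrs G v" by (simp add: arcs_symmetric)
    then show ?thesis by blast
  qed simp
qed

text \<open>The two degree hypotheses ensure that deleting the edge isolates neither endpoint, so
  that the minimum is attained on both sides.\<close>

lemma two_level_gamma_tR_del_edge:
  assumes "pair_graph G" "two_level G c" "(c, l) \<in> parcs G"
    and "card (nbrs G c) \<noteq> 1" "card (nbrs G l) \<noteq> 1"
  shows "gamma_tR G < gamma_tR (del_edge G c l)"
proof -
  interpret pair_graph G by fact
  define D where "D = del_edge G c l"
  interpret D: pair_graph D
    unfolding D_def by (rule pair_graph_del_edge)
  have pend: "nbrs G w = {m}" if "(c, m) \<in> parcs G" "(m, w) \<in> parcs G" "w \<noteq> c" for m w
    using assms(2) that unfolding two_level_def Ball_def in_nbrs_iff by blast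
  have arcD: "(x, y) \<in> parcs D \<longleftrightarrow> (x, y) \<in> parcs G \<and> (x, y) \<noteq> (c, l) \<and> (x, y) \<noteq> (l, c)" for x y
    by (simp add: D_def)
  have vD: "pverts D = pverts G"
    by (simp add: D_def)
  have wD: "trd_weight D = trd_weight G"
    by (auto simp: D_def)
  have cv: "c \<in> pverts G" and lv: "l \<in> pverts G" and cl: "c \<noteq> l" and lc: "(l, c) \<in> parcs G"
    using assms(3) in_arcsD1 in_arcsD2 no_loops' arcs_symmetric by blast+
  have "nbrs G c \<noteq> {l}" "nbrs G l \<noteq> {c}"
    using assms(4,5) by auto
  then have "nbrs D c \<noteq> {}" "nbrs D l \<noteq> {}"
    using assms(3) lc cl by (auto simp: set_eq_iff arcD)
  moreover have "nbrs D v = nbrs G v" if "v \<noteq> c" "v \<noteq> l" for v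
    using that by (auto simp: arcD)
  ultimately have "no_isolated_verts D"
    using two_level_nbrs_ne[OF assms(1,2)]
    unfolding no_isolated_verts_pair_iff[OF D.pair_graph] vD by metis
  then obtain g where g: "trd_function D g" "trd_weight D g = gamma_tR D"
    using gamma_tR_attained[OF D.pair_graph] by blast
  \<comment> \<open>If \<open>g c = 0\<close>, then \<open>c\<close> has a neighbour of value \<open>2\<close> with a positive pendant vertex;
    the value of that pendant vertex is moved to \<open>c\<close>.\<close>
  obtain h where h: "trd_function D h" "h c > 0" "trd_weight G h \<le> trd_weight G g"
  proof (cases "g c = 0")
    case False
    then show ?thesis
      using that g by simp
  next
    case True
    then obtain m where m: "(c, m) \<in> parcs D" "g m = 2"
      using trd_functionD(2)[OF D.pair_graph g(1)] cv vD by metis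
    then have mv: "m \<in> pverts G"
      using D.in_arcsD2 vD by blast
    then obtain p where p: "(m, p) \<in> parcs D" "g p > 0"
      using trd_functionD(3)[OF D.pair_graph g(1)] m(2) vD by (metis zero_less_numeral)
    have pc: "p \<noteq> c"
      using p True by auto
    have np: "nbrs G p = {m}"
      using pend m p pc by (auto simp: arcD)
    have pv: "p \<in> pverts G"
      using p D.in_arcsD2 vD by blast
    have pm: "(x, p) \<in> parcs D \<longleftrightarrow> x = m" for x
      using np p D.arcs_symmetric arcs_symmetric by (auto simp: set_eq_iff arcD)
    have "m \<noteq> c" "m \<noteq> p"
      using m p D.no_loops' by blast+
    have "trd_function D (g(c := 1, p := 0))"
      unfolding trd_function_iff[OF D.pair_graph] vD
    proof (intro conjI ballI impI)
      fix v assume v: "v \<in> pverts G"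
      show "(g(c := 1, p := 0)) v \<le> 2"
        using trd_functionD(1)[OF D.pair_graph g(1)] v vD by auto
      show "\<exists>u\<in>nbrs D v. (g(c := 1, p := 0)) u = 2" if 0: "(g(c := 1, p := 0)) v = 0"
      proof (cases "v = p")
        case True
        then show ?thesis
          using m \<open>m \<noteq> c\<close> \<open>m \<noteq> p\<close> pm D.arcs_symmetric
          by (intro bexI[of _ m]) auto
      next
        case False
        then have "g v = 0" "v \<noteq> c"
          using 0 by (auto split: if_splits)
        then obtain u where u: "(v, u) \<in> parcs D" "g u = 2"
          using trd_functionD(2)[OF D.pair_graph g(1)] v vD by metis
        \<comment> \<open>\<open>u\<close> is not \<open>c\<close> because \<open>g c = 0\<close>,
          and not \<open>p\<close> because the only neighbour \<open>m\<close> of \<open>p\<close>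
          has value 2 while \<open>g v = 0\<close>.\<close>
        then have "u \<noteq> c" "u \<noteq> p"
          using True pm \<open>g v = 0\<close> m by auto
        then show ?thesis
          using u by (intro bexI[of _ u]) auto
      qed
      show "\<exists>u\<in>nbrs D v. (g(c := 1, p := 0)) u > 0" if pos: "(g(c := 1, p := 0)) v > 0"
      proof -
        consider "v = c" | "v = m" | "v \<noteq> c" "v \<noteq> m" "g v > 0"
          using pos by (auto split: if_splits)
        then show ?thesis
        proof cases
          case 1
          then show ?thesis
            using m \<open>m \<noteq> p\<close> by (intro bexI[of _ m]) auto
        next
          case 2
          then show ?thesis
            using m pc D.arcs_symmetric by (intro bexI[of _ c]) auto
        next
          case 3
          then obtain u where u: "(v, u) \<in> parcs D" "g u > 0"
            using trd_functionD(3)[OF D.pair_graph g(1)] v vD by metis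
          then have "u \<noteq> p"
            using 3 pm by auto
          then show ?thesis
            using u by (intro bexI[of _ u]) auto
        qed
      qed
    qed
    moreover have "trd_weight G (g(c := 1, p := 0)) \<le> trd_weight G g"
      using trd_weight_upd[OF pair_finite_verts cv, of g 1] p(2) True pc
        trd_weight_upd[OF pair_finite_verts pv, of "g(c := 1)" 0] by simp
    ultimately show ?thesis
      using that pc by simp
  qed
  define Q where "Q = nbrs G l - {c}"
  have nQ: "nbrs G q = {l}" if "q \<in> Q" for q
    using pend[OF assms(3)] that unfolding Q_def by auto
  have Qarc: "(l, q) \<in> parcs D" "(q, x) \<in> parcs G \<longleftrightarrow> x = l" "(x, q) \<in> parcs G \<longleftrightarrow> x = l"
    if "q \<in> Q" for q x
    using nQ[OF that] that cl arcs_symmetric by (auto simp: set_eq_iff arcD Q_def)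
  have lQ: "l \<notin> Q" "c \<notin> Q" "finite Q"
    using no_loops' by (auto simp: Q_def)
  have Dl: "nbrs D l = Q"
    using cl by (auto simp: arcD Q_def)
  have Qv: "Q \<subseteq> pverts G"
    by (auto simp: Q_def dest: in_arcsD2)
  \<comment> \<open>After the deletion \<open>l\<close> has only its pendant vertices
    \<open>Q\<close> as neighbours, at least two in number. If \<open>h l = 2\<close>, some vertex
    of \<open>Q\<close> must be positive; otherwise all of \<open>Q\<close> is positive, and so is
    \<open>l\<close>.\<close>
  have hl: "3 \<le> h l + sum h Q"
  proof -
    have "card (nbrs G l) = Suc (card Q)"
      using lc lQ unfolding Q_def by (metis card.remove finite_nbrs in_nbrs_iff)
    moreover have "card Q \<noteq> 1"
      using assms(2,3) unfolding two_level_def Q_def by auto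
    ultimately have card: "2 \<le> card Q"
      using assms(5) by linarith
    have leaf: "(h q = 0 \<longrightarrow> h l = 2) \<and> (h q > 0 \<longrightarrow> h l > 0)" if "q \<in> Q" for q
    proof -
      have "q \<in> pverts D" "nbrs D q = {l}"
        using Qv vD Qarc[OF that] D.arcs_symmetric that by (auto simp: arcD)
      then show ?thesis
        using trd_functionD(2,3)[OF D.pair_graph h(1)] by (metis in_nbrs_iff singletonD)
    qed
    show ?thesis
    proof (cases "h l = 2")
      case True
      then obtain q where q: "q \<in> Q" "h q > 0"
        using trd_functionD(3)[OF D.pair_graph h(1)] lv Dl vD
        by (metis in_nbrs_iff zero_less_numeral)
      then have "h q \<le> sum h Q"
        using lQ by (intro member_le_sum) auto
      then show ?thesis
        using True q by linarith
    next
      case False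
      then have pos: "\<forall>q \<in> Q. h q \<ge> 1"
        using leaf by force
      have "card Q \<le> sum h Q"
        using sum_bounded_below[of Q 1 h] pos by simp
      moreover have "h l > 0"
        using leaf pos card by (metis card.empty ex_in_conv le_zero_eq less_le_trans
            zero_less_one zero_neq_numeral)
      ultimately show ?thesis
        using card by linarith
    qed
  qed
  \<comment> \<open>With the edge restored, the positive vertex \<open>c\<close> is a positive
    neighbour of \<open>l\<close>, so \<open>Q\<close> can be set to 0; the weight on
    \<open>l\<close> and \<open>Q\<close> drops from at least 3 to 2.\<close>
  define f where "f x = (if x = l then 2 else if x \<in> Q then 0 else h x)" for x
  have "trd_function G f"
    unfolding trd_function_iff[OF assms(1)]
  proof (intro conjI ballI impI)
    fix v assume v: "v \<in> pverts G"
    show "f v \<le> 2"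
      using trd_functionD(1)[OF D.pair_graph h(1)] v vD by (auto simp: f_def)
    show "\<exists>u\<in>nbrs G v. f u = 2" if 0: "f v = 0"
    proof (cases "v \<in> Q")
      case True
      then show ?thesis
        using Qarc[OF True] by (intro bexI[of _ l]) (auto simp: f_def)
    next
      case False
      then have v0: "h v = 0" "v \<noteq> l" "v \<noteq> c"
        using 0 h(2) by (auto simp: f_def split: if_splits)
      then obtain u where u: "(v, u) \<in> parcs D" "h u = 2"
        using trd_functionD(2)[OF D.pair_graph h(1)] v vD by metis
      then have "u \<notin> Q" "(u, v) \<in> parcs G"
        using v0 Qarc(3)[of u v] arcs_symmetric by (auto simp: arcD)
      moreover have "u \<noteq> l"
        using False v0 \<open>(u, v) \<in> parcs G\<close> by (auto simp: Q_def)
      ultimately show ?thesis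
        using u by (intro bexI[of _ u]) (auto simp: f_def arcD)
    qed
    show "\<exists>u\<in>nbrs G v. f u > 0" if pos: "f v > 0"
    proof (cases "v = l")
      case True
      then show ?thesis
        using lc h(2) lQ cl by (intro bexI[of _ c]) (auto simp: f_def)
    next
      case False
      then have "v \<notin> Q" "h v > 0"
        using pos by (auto simp: f_def split: if_splits)
      then obtain u where u: "(v, u) \<in> parcs D" "h u > 0"
        using trd_functionD(3)[OF D.pair_graph h(1)] v vD by metis
      then have "u \<notin> Q"
        using False Qarc(3)[of u v] by (auto simp: arcD)
      then show ?thesis
        using u by (intro bexI[of _ u]) (auto simp: f_def arcD)
    qed
  qed
  then have "gamma_tR G \<le> trd_weight G f"
    by (rule gamma_tR_le[OF assms(1)])
  also have "\<dots> < trd_weight G h"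
  proof -
    \<comment> \<open>Outside \<open>l\<close> and \<open>Q\<close> the functions \<open>f\<close>
      and \<open>h\<close> agree.\<close>
    define R where "R = pverts G - insert l Q"
    have split: "trd_weight G k = k l + sum k Q + sum k R" for k
    proof -
      have "pverts G = insert l Q \<union> R" "insert l Q \<inter> R = {}" "finite R"
        using Qv lv pair_finite_verts by (auto simp: R_def)
      then show ?thesis
        using lQ by (simp add: trd_weight_def sum.union_disjoint)
    qed
    have "sum f Q = 0" "sum f R = sum h R" "f l = 2"
      using lQ by (auto simp: f_def R_def intro!: sum.cong)
    then show ?thesis
      using split[of f] split[of h] hl by linarith
  qed
  also have "\<dots> \<le> gamma_tR D"
    using h(3) g(2) wD by simp
  finally show ?thesis
    by (simp add: D_def)
qed

text \<open>Edges at a vertex of degree 1 are critical by convention. Every other edge joins the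
  centre to a leaf, since pendant vertices have degree 1.\<close>

lemma two_level_imp_critical:
  assumes "pair_graph G" "two_level G c"
  shows "gamma_tR_ER_critical G"
proof -
  interpret pair_graph G by fact
  have "no_isolated_verts G"
    using two_level_nbrs_ne[OF assms] by (simp add: no_isolated_verts_pair_iff[OF assms(1)])
  moreover have "enat (gamma_tR G) < gamma_tR_del G u v" if uv: "(u, v) \<in> parcs G" for u v
  proof (cases "card (nbrs G u) = 1 \<or> card (nbrs G v) = 1")
    case True
    then show ?thesis
      by (auto simp: gamma_tR_del_def out_degree_eq_card_nbrs)
  next
    case False
    then have deg: "card (nbrs G u) \<noteq> 1" "card (nbrs G v) \<noteq> 1"
      by auto
    have two: "\<forall>v \<in> pverts G. v = c \<or> v \<in> nbrs G c \<or> (\<exists>l \<in> nbrs G c. nbrs G v = {l})"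
      "\<forall>l \<in> nbrs G c. \<forall>w \<in> nbrs G l. w = c \<or> nbrs G w = {l}"
      using assms(2) unfolding two_level_def by blast+
    have "u = c \<or> u \<in> nbrs G c"
      using two(1) deg(1) in_arcsD1[OF uv] by fastforce
    then have "u = c \<or> v = c"
      using two(2) deg(2) uv by fastforce
    then have "gamma_tR G < gamma_tR (del_edge G u v)"
      using two_level_gamma_tR_del_edge[OF assms] uv deg arcs_symmetric del_edge_commute by metis
    then show ?thesis
      using deg by (simp add: gamma_tR_del_def out_degree_eq_card_nbrs)
  qed
  ultimately show ?thesis
    by (auto simp: gamma_tR_ER_critical_def)
qed


section \<open>Critical graphs are two-level trees\<close>

text \<open>The condition on \<open>u\<close> for being dominated, or for not being isolated among the positive
  vertices, is met only through \<open>v\<close>.\<close>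

definition private_arc :: "'a pair_pre_digraph \<Rightarrow> ('a \<Rightarrow> nat) \<Rightarrow> 'a \<Rightarrow> 'a \<Rightarrow> bool" where
  "private_arc G f u v \<longleftrightarrow>
     (f u = 0 \<and> f v = 2 \<and> (\<forall>w \<in> nbrs G u. f w = 2 \<longrightarrow> w = v)) \<or>
     (f u > 0 \<and> f v > 0 \<and> (\<forall>w \<in> nbrs G u. f w > 0 \<longrightarrow> w = v))"

text \<open>Deleting \<open>uv\<close> can only spoil the conditions at \<open>u\<close> and
  \<open>v\<close>, and if the edge is private for neither endpoint, each has another suitable
  neighbour.\<close>

lemma trd_function_del_edge:
  assumes "pair_graph G" "trd_function G f" "(u, v) \<in> parcs G"
    and np: "\<not> private_arc G f u v" "\<not> private_arc G f v u"
  shows "trd_function (del_edge G u v) f"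
proof -
  interpret pair_graph G by fact
  have uv: "u \<noteq> v"
    using assms(3) no_loops' by blast
  note f = trd_functionD[OF assms(1,2)]
  show ?thesis
    unfolding trd_function_iff[OF pair_graph_del_edge] pverts_del_edge
  proof (intro conjI ballI impI)
    fix x assume x: "x \<in> pverts G"
    then show "f x \<le> 2" by (rule f)
    show "\<exists>y\<in>nbrs (del_edge G u v) x. f y = 2" if 0: "f x = 0"
    proof -
      obtain y where y: "(x, y) \<in> parcs G" "f y = 2"
        using f(2)[OF x 0] by auto
      obtain w where "(x, w) \<in> parcs G" "f w = 2" "x = u \<longrightarrow> w \<noteq> v" "x = v \<longrightarrow> w \<noteq> u"
        using y np uv 0 unfolding private_arc_def by (metis in_nbrs_iff)
      then show ?thesis
        by (intro bexI[of _ w]) auto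
    qed
    show "\<exists>y\<in>nbrs (del_edge G u v) x. f y > 0" if pos: "f x > 0"
    proof -
      obtain y where y: "(x, y) \<in> parcs G" "f y > 0"
        using f(3)[OF x pos] by auto
      obtain w where "(x, w) \<in> parcs G" "f w > 0" "x = u \<longrightarrow> w \<noteq> v" "x = v \<longrightarrow> w \<noteq> u"
        using y np uv pos unfolding private_arc_def by (metis in_nbrs_iff)
      then show ?thesis
        by (intro bexI[of _ w]) auto
    qed
  qed
qed

lemma critical_trd_weight_del_edge:
  assumes "pair_graph G" "gamma_tR_ER_critical G" "(u, v) \<in> parcs G"
    and "card (nbrs G u) \<noteq> 1" "card (nbrs G v) \<noteq> 1" "trd_function (del_edge G u v) f"
  shows "gamma_tR G < trd_weight G f"
proof -
  interpret pair_graph G by fact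
  have "enat (gamma_tR G) < gamma_tR_del G u v"
    using assms(2,3) by (auto simp: gamma_tR_ER_critical_def)
  then have "gamma_tR G < gamma_tR (del_edge G u v)"
    using assms(4,5) by (simp add: gamma_tR_del_def out_degree_eq_card_nbrs)
  also have "\<dots> \<le> trd_weight G f"
    using gamma_tR_le[OF pair_graph_del_edge assms(6)] by simp
  finally show ?thesis .
qed

text \<open>Otherwise \<open>f\<close> would survive the deletion of the edge, contradicting
  criticality. An edge at a vertex of degree 1, where the deletion yields no function, is private
  because that vertex has no other neighbour.\<close>

lemma critical_imp_private_arc:
  assumes "pair_graph G" "gamma_tR_ER_critical G" "(u, v) \<in> parcs G"
    and "trd_function G f" "trd_weight G f = gamma_tR G"
  shows "private_arc G f u v \<or> private_arc G f v u"
proof -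
  interpret pair_graph G by fact
  have pendant: "private_arc G f x y" if "card (nbrs G x) = 1" "(x, y) \<in> parcs G" for x y
  proof -
    have "nbrs G x = {y}"
      using that by (metis card_1_singletonE in_nbrs_iff singletonD)
    moreover have "x \<in> pverts G"
      using that in_arcsD1 by blast
    ultimately show ?thesis
      using assms(4) unfolding trd_function_iff[OF assms(1)] private_arc_def by fastforce
  qed
  show ?thesis
  proof (cases "card (nbrs G u) = 1 \<or> card (nbrs G v) = 1")
    case True
    then show ?thesis
      using pendant assms(3) arcs_symmetric by blast
  next
    case False
    then show ?thesis
      using critical_trd_weight_del_edge[OF assms(1-3)] trd_function_del_edge[OF assms(1,4,3)]
        assms(5) by (metis less_irrefl)
  qed
qed

lemma critical_imp_two_level:
  assumes "pair_graph G" "connected G" "gamma_tR_ER_critical G"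
  shows "\<exists>c. two_level G c"
proof -
  interpret pair_graph G by fact
  have "no_isolated_verts G"
    using assms(3) by (simp add: gamma_tR_ER_critical_def)
  then obtain f where f: "trd_function G f" "trd_weight G f = gamma_tR G"
    using gamma_tR_attained[OF assms(1)] by blast
  note f2 = trd_functionD(1)[OF assms(1) f(1)]
    and f_0 = trd_functionD(2)[OF assms(1) f(1)]
    and f_pos = trd_functionD(3)[OF assms(1) f(1)]
  note priv = critical_imp_private_arc[OF assms(1,3) _ f]
  \<comment> \<open>An edge at a vertex \<open>z\<close> of value 0 can be private only for
    \<open>z\<close>, which forces its other end to be the vertex \<open>w\<close> that dominates
    \<open>z\<close>.\<close>
  have zero: "\<exists>w. nbrs G z = {w} \<and> f w = 2" if z: "z \<in> pverts G" "f z = 0" for z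
  proof -
    obtain w where w: "(z, w) \<in> parcs G" "f w = 2"
      using f_0[OF z] by blast
    have "x = w" if "(z, x) \<in> parcs G" for x
      using priv[OF that] z(2) w unfolding private_arc_def by auto
    then have "nbrs G z = {w}"
      using w unfolding nbrs_def by blast
    then show ?thesis
      using w by blast
  qed
  \<comment> \<open>One end of each edge between positive vertices has no further positive
    neighbour: the positive vertices induce a star forest.\<close>
  have pos_edge: "(\<forall>w. (u, w) \<in> parcs G \<longrightarrow> f w > 0 \<longrightarrow> w = v) \<or>
      (\<forall>w. (v, w) \<in> parcs G \<longrightarrow> f w > 0 \<longrightarrow> w = u)"
    if "(u, v) \<in> parcs G" "f u > 0" "f v > 0" for u v
    using priv[OF that(1)] that(2,3)[THEN gr_implies_not0]
    unfolding private_arc_def Ball_def in_nbrs_iff by blast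
  \<comment> \<open>The centre is a vertex with two positive neighbours if there is one; it is arbitrary if the
    positive vertices induce a matching.\<close>
  define branching where
    "branching u \<longleftrightarrow> (\<exists>x y. x \<noteq> y \<and> (u, x) \<in> parcs G \<and> (u, y) \<in> parcs G \<and> f x > 0 \<and> f y > 0)" for u
  obtain v0 where "v0 \<in> pverts G" "f v0 > 0"
  proof -
    obtain v where v: "v \<in> pverts G"
      using assms(2) by (auto simp: connected_def strongly_connected_def)
    show ?thesis
    proof (cases "f v = 0")
      case True
      then show ?thesis
        using f_0[OF v] in_arcsD2 that by (metis zero_less_numeral)
    qed (use v that in blast)
  qed
  then obtain c where c: "c \<in> pverts G" "f c > 0"
    and branch: "\<And>u. u \<in> pverts G \<Longrightarrow> f u > 0 \<Longrightarrow> branching u \<Longrightarrow> branching c"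
    by metis
  have ne: "nbrs G c \<noteq> {}"
    using f_pos[OF c] by auto
  \<comment> \<open>\<open>l\<close> is positive, as it has two neighbours. If \<open>w\<close> were
    positive too, \<open>l\<close> would be branching, hence also \<open>c\<close> by its choice,
    and the edge \<open>lc\<close> would violate \<open>pos_edge\<close>.\<close>
  have second: "f w = 0 \<and> nbrs G w = {l}"
    if lw: "(c, l) \<in> parcs G" "(l, w) \<in> parcs G" "w \<noteq> c" for l w
  proof -
    have lv: "l \<in> pverts G" and wv: "w \<in> pverts G" and lc: "(l, c) \<in> parcs G"
      using lw in_arcsD2 arcs_symmetric by blast+
    have "\<not> f l = 0"
    proof
      assume "f l = 0"
      then obtain x where "nbrs G l = {x}"
        using zero lv by blast
      then show False
        using lc lw by (metis in_nbrs_iff singletonD)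
    qed
    have "f w = 0"
    proof (rule ccontr)
      assume "f w \<noteq> 0"
      then have "branching l"
        unfolding branching_def using lw lc c(2) by blast
      then have "branching c"
        using branch lv \<open>\<not> f l = 0\<close> by blast
      then show False
        using pos_edge[OF lc] c(2) \<open>\<not> f l = 0\<close> \<open>f w \<noteq> 0\<close> lw unfolding branching_def
        by (metis bot_nat_0.not_eq_extremum)
    qed
    moreover have "nbrs G w = {l}"
      using zero[OF wv] calculation arcs_symmetric[OF lw(2)] by (metis in_nbrs_iff singletonD)
    ultimately show ?thesis by blast
  qed
  \<comment> \<open>Induction along a path from \<open>c\<close>: by \<open>second\<close> a step
    from a leaf leads to \<open>c\<close> or to a pendant vertex, and a pendant vertex leads only
    back to its leaf.\<close>
  have verts: "v = c \<or> (c, v) \<in> parcs G \<or> (\<exists>l \<in> nbrs G c. nbrs G v = {l})"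
    if "v \<in> pverts G" for v
  proof -
    have "strongly_connected G"
      using symmetric_connected_imp_strongly_connected[OF pair_sym_arcs assms(2)] .
    then have "c \<rightarrow>\<^sup>*\<^bsub>G\<^esub> v"
      using c(1) that by (auto simp: strongly_connected_def)
    then show ?thesis
    proof (induction rule: reachable_induct)
      case base
      then show ?case by simp
    next
      case (step x y)
      then have xy: "(x, y) \<in> parcs G"
        by simp
      show ?case
      proof (cases "x = c \<or> y = c")
        case True
        then show ?thesis
          using xy by auto
      next
        case False
        then consider "(c, x) \<in> parcs G" | l where "(c, l) \<in> parcs G" "nbrs G x = {l}"
          using step.IH by auto
        then show ?thesis
        proof cases
          case 1
          then show ?thesis
            using second[OF 1 xy] False by auto
        next
          case 2
          then show ?thesis
            using xy by (metis in_nbrs_iff singletonD)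
        qed
      qed
    qed
  qed
  show ?thesis
  proof (cases "\<forall>l \<in> nbrs G c. card (nbrs G l - {c}) \<noteq> 1")
    case True
    then have "two_level G c"
      using c(1) ne verts second unfolding two_level_def by auto
    then show ?thesis by blast
  next
    case False
    then obtain l p where l: "(c, l) \<in> parcs G" and lp: "nbrs G l - {c} = {p}"
      by (metis card_1_singletonE in_nbrs_iff)
    have lc: "(l, c) \<in> parcs G"
      using l arcs_symmetric by blast
    have "p \<in> nbrs G l - {c}"
      unfolding lp by simp
    then have p: "(l, p) \<in> parcs G" "p \<noteq> c"
      by simp_all
    have nl: "nbrs G l = {c, p}"
      unfolding lp[symmetric] using lc by (simp add: insert_absorb)
    have fp: "f p = 0" and np: "nbrs G p = {l}"
      using second[OF l p] by auto
    have vs: "l \<in> pverts G" "p \<in> pverts G"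
      using l p in_arcsD2 by blast+
    have fl: "f l = 2"
      using zero[OF vs(2) fp] np by auto
    have dist: "l \<noteq> c" "l \<noteq> p"
      using lc p no_loops' by blast+
    have pl: "(p, l) \<in> parcs G"
      using p arcs_symmetric by blast
    have cardl: "card (nbrs G l) \<noteq> 1"
      using nl p by simp
    show ?thesis
    proof (cases "\<exists>m. (c, m) \<in> parcs G \<and> m \<noteq> l \<and> f m > 0")
      case True
      then obtain m where m: "(c, m) \<in> parcs G" "m \<noteq> l" "f m > 0"
        by blast
      \<comment> \<open>The values 2 and 0 on \<open>l\<close> and \<open>p\<close> become 1 and 1
        at equal weight. Now \<open>l\<close> and \<open>p\<close> support each other,
        \<open>c\<close> is supported by \<open>m\<close>, and no other vertex of value 0 is
        adjacent to \<open>l\<close>, so the edge \<open>cl\<close> can be deleted.\<close>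
      define f' where "f' = f(l := 1, p := 1)"
      have f'l: "f' l = 1" "f' p = 1" "\<And>x. x \<noteq> l \<Longrightarrow> x \<noteq> p \<Longrightarrow> f' x = f x"
        by (auto simp: f'_def dist)
      have f'pos: "f' x > 0" if "f x > 0" for x
        using that by (auto simp: f'_def)
      have "trd_function (del_edge G c l) f'"
        unfolding trd_function_iff[OF pair_graph_del_edge] pverts_del_edge
      proof (intro conjI ballI impI)
        fix v assume v: "v \<in> pverts G"
        show "f' v \<le> 2"
          using f2[OF v] by (auto simp: f'_def)
        show "\<exists>y\<in>nbrs (del_edge G c l) v. f' y = 2" if 0: "f' v = 0"
        proof -
          have v': "v \<noteq> l" "v \<noteq> p" "f v = 0" "v \<noteq> c"
            using 0 c(2) by (auto simp: f'_def split: if_splits)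
          then obtain w where w: "nbrs G v = {w}" "f w = 2"
            using zero[OF v] by blast
          then have vw: "(v, w) \<in> parcs G"
            by (metis in_nbrs_iff singletonI)
          then have "w \<noteq> l"
            using nl v' arcs_symmetric by (metis in_nbrs_iff insertE singletonD)
          moreover have "w \<noteq> p"
            using w fp by auto
          ultimately show ?thesis
            using vw v' w f'l by (intro bexI[of _ w]) auto
        qed
        show "\<exists>y\<in>nbrs (del_edge G c l) v. f' y > 0" if pos: "f' v > 0"
        proof -
          consider "v = l" | "v = p" | "v = c" | "v \<noteq> l" "v \<noteq> c" "f v > 0"
            using pos f'l(3)[of v] by force
          then show ?thesis
          proof cases
            case 1
            then show ?thesis
              using p f'l dist by (intro bexI[of _ p]) auto
          next
            case 2
            then show ?thesis
              using pl p(2) dist f'l by (intro bexI[of _ l]) auto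
          next
            case 3
            then show ?thesis
              using m dist f'pos by (intro bexI[of _ m]) auto
          next
            case 4
            then obtain u where "(v, u) \<in> parcs G" "f u > 0"
              using f_pos[OF v] by blast
            then show ?thesis
              using 4 f'pos by (intro bexI[of _ u]) auto
          qed
        qed
      qed
      moreover have "card (nbrs G c) \<noteq> 1"
        using l m by (metis card_1_singletonE in_nbrs_iff singletonD)
      ultimately have "gamma_tR G < trd_weight G f'"
        using critical_trd_weight_del_edge[OF assms(1,3) l] cardl by blast
      moreover have "trd_weight G f' = trd_weight G f"
        using trd_weight_upd[OF pair_finite_verts vs(1), of f 1] fl fp dist
          trd_weight_upd[OF pair_finite_verts vs(2), of "f(l := 1)" 1] by (simp add: f'_def)
      ultimately show ?thesis
        using f(2) by simp
    next
      case False
      \<comment> \<open>Here \<open>c\<close> and \<open>l\<close> are the ends of a single positive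
        edge, and \<open>l\<close> takes over as the centre, with leaves \<open>c\<close> and
        \<open>p\<close>.\<close>
      have nc: "f z = 0 \<and> nbrs G z = {c}" if "(c, z) \<in> parcs G" "z \<noteq> l" for z
      proof -
        have "f z = 0"
          using False that by auto
        moreover have "(z, c) \<in> parcs G" "z \<in> pverts G"
          using that arcs_symmetric in_arcsD2 by blast+
        ultimately show ?thesis
          using zero[of z] by (metis in_nbrs_iff singletonD)
      qed
      have vl: "v = l \<or> v \<in> nbrs G l \<or> nbrs G v = {c}" if v: "v \<in> pverts G" for v
      proof -
        consider "v = c" | "v = l" | "(c, v) \<in> parcs G" "v \<noteq> l"
          | l' where "(c, l') \<in> parcs G" "nbrs G v = {l'}"
          using verts[OF v] by auto
        then show ?thesis
        proof cases
          case 4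
          then have "(l', v) \<in> parcs G"
            using arcs_symmetric by (metis in_nbrs_iff singletonI)
          then show ?thesis
            using nc[OF 4(1)] lc by (metis in_nbrs_iff singletonD)
        qed (use nc lc in simp_all)
      qed
      \<comment> \<open>If \<open>c\<close> had just one further neighbour \<open>z\<close>, then
        \<open>G\<close> would be the path \<open>p\<close>, \<open>l\<close>, \<open>c\<close>,
        \<open>z\<close> with values 0, 2, 2, 0. The constant 1 has the same weight 4 and survives
        the deletion of the middle edge.\<close>
      have "card (nbrs G c - {l}) \<noteq> 1"
      proof
        assume "card (nbrs G c - {l}) = 1"
        then obtain z where cz: "nbrs G c - {l} = {z}"
          by (rule card_1_singletonE)
        have "z \<in> nbrs G c - {l}"
          unfolding cz by simp
        then have z: "(c, z) \<in> parcs G" "z \<noteq> l"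
          by simp_all
        have fz: "f z = 0" and nz: "nbrs G z = {c}"
          using nc[OF z] by auto
        have zv: "z \<in> pverts G"
          using z in_arcsD2 by blast
        have fc: "f c = 2"
          using zero[OF zv fz] nz by auto
        have zd: "z \<noteq> c" "z \<noteq> p"
          using z(1) no_loops' nz np dist by auto
        have zc: "(z, c) \<in> parcs G"
          using z arcs_symmetric by blast
        have all: "v \<in> {c, l, p, z}" if "v \<in> pverts G" for v
        proof -
          have "v \<in> nbrs G c" if "nbrs G v = {c}"
            using that arcs_symmetric by (metis in_nbrs_iff singletonI)
          then show ?thesis
            using vl[OF that] nl cz by blast
        qed
        define f' where "f' = f(l := 1, p := 1, c := 1, z := 1)"
        have f': "f' c = 1" "f' l = 1" "f' p = 1" "f' z = 1"
          using dist zd p(2) by (auto simp: f'_def)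
        have "trd_function (del_edge G c l) f'"
          unfolding trd_function_iff[OF pair_graph_del_edge] pverts_del_edge
        proof (intro conjI ballI impI)
          fix v assume v: "v \<in> pverts G"
          show "f' v \<le> 2" "f' v = 0 \<Longrightarrow> \<exists>y\<in>nbrs (del_edge G c l) v. f' y = 2"
            using all[OF v] f' by auto
          consider "v = c" | "v = l" | "v = p" | "v = z"
            using all[OF v] by blast
          then show "\<exists>y\<in>nbrs (del_edge G c l) v. f' y > 0"
          proof cases
            case 1
            then show ?thesis using z dist f' by (intro bexI[of _ z]) auto
          next
            case 2
            then show ?thesis using p dist f' by (intro bexI[of _ p]) auto
          next
            case 3
            then show ?thesis using pl p dist f' by (intro bexI[of _ l]) auto
          next
            case 4
            then show ?thesis using zc z zd f' by (intro bexI[of _ c]) auto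
          qed
        qed
        moreover have "card (nbrs G c) \<noteq> 1"
          using l z by (metis card_1_singletonE in_nbrs_iff singletonD)
        ultimately have "gamma_tR G < trd_weight G f'"
          using critical_trd_weight_del_edge[OF assms(1,3) l] cardl by blast
        moreover have "trd_weight G f' = trd_weight G f"
          using trd_weight_upd[OF pair_finite_verts vs(1), of f 1] fl fp dist fc fz zd z(2) p(2)
            trd_weight_upd[OF pair_finite_verts vs(2), of "f(l := 1)" 1]
            trd_weight_upd[OF pair_finite_verts c(1), of "f(l := 1, p := 1)" 1]
            trd_weight_upd[OF pair_finite_verts zv, of "f(l := 1, p := 1, c := 1)" 1]
          by (simp add: f'_def)
        ultimately show False
          using f(2) by simp
      qed
      moreover have "\<forall>x \<in> nbrs G l. \<forall>w \<in> nbrs G x. w = l \<or> nbrs G w = {x}"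
        unfolding nl using nc by (simp add: np del: in_nbrs_iff) (metis in_nbrs_iff)
      moreover have "card (nbrs G p - {l}) \<noteq> 1"
        by (simp add: np)
      moreover have "\<forall>v \<in> pverts G. v = l \<or> v \<in> nbrs G l \<or> (\<exists>x \<in> nbrs G l. nbrs G v = {x})"
        using vl lc by (metis in_nbrs_iff)
      ultimately have "two_level G l"
        using vs(1) unfolding two_level_def by (simp add: nl del: in_nbrs_iff)
      then show ?thesis by blast
    qed
  qed
qed

theorem theorem7p11:
  fixes G :: "'a pair_pre_digraph"
  assumes "pair_graph G"
    and "connected G"
    and "no_isolated_verts G"
  shows "gamma_tR_ER_critical G \<longleftrightarrow>
    (\<exists>(n::nat) (k :: nat \<Rightarrow> nat). n \<ge> 1 \<and>
       (\<forall>i \<in> {1..n}. \<forall>j \<in> {1..n}. i \<le> j \<longrightarrow> k i \<ge> k j) \<and>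
       (\<forall>i \<in> {1..n}. k i \<noteq> 1) \<and>
       digraph_iso G (star_with_pendants n k))"
  using critical_imp_two_level[OF assms(1,2)] two_level_imp_critical[OF assms(1)]
    two_level_iff_digraph_iso[OF assms(1)] by blast

end
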